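(* Let $\boldsymbol\tau = (\tau_n \colon \mathcal A_{n+1}^* \to \mathcal A_n^* : n \geq 0)$ be an everywhere growing directive sequence. \begin{enumerate} \item[(1)] If $\boldsymbol\tau$ is proper, then it is decisive. \item[(2)] If $|\tau_n(a)| \geq 2$ for all $n \geq 0$ and $a \in \mathcal A_{n+1}$, then the centered $1$-block presentation $\boldsymbol\tau^{[1]}$ of $\boldsymbol\tau$ is decisive. \end{enumerate}
   Context: Alphabets are finite sets with at least two elements. $\mathcal A^*$ is the free monoid of finite words and $|w|$ the length of $w$. $\mathcal L(X)$ is the set of finite words occurring in points of a subshift $X$, and $\mathcal L_k(X)$ the set of those of length $k$. A substitution $\tau:\mathcal A^*\to\mathcal B^*$ is a monoid morphism such that $\tau(a)$ is non-empty for every $a\in\mathcal A$ and every $b\in\mathcal B$ occurs in some $\tau(a)$; it is proper if there are letters $b,b'\in\mathcal B$ such that every $\tau(a)$, $a\in\mathcal A$, starts with $b$ and ends with $b'$. A directive sequence $\boldsymbol\tau=(\tau_n)_{n\ge0}$ consists of substitutions $\tau_n:\mathcal A_{n+1}^*\to\mathcal A_n^*$; it is proper if every $\tau_n$ is proper. Put $\tau_{n,m}=\tau_n\circ\cdots\circ\tau_{m-1}$ for $m>n$. $X^{(n)}_{\boldsymbol\tau}$ is the set of $x\in\mathcal A_n^{\mathbb Z}$ such that every finite factor of $x$ occurs in $\tau_{n,m}(a)$ for some $m>n$ and $a\in\mathcal A_m$. $\boldsymbol\tau$ is everywhere growing if $\min_{a\in\mathcal A_n}|\tau_{0,n}(a)|\to\infty$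 as $n\to\infty$. An everywhere growing directive sequence is decisive if for every $n\ge0$ there exist maps $\ell,r:\mathcal A_{n+1}\to\mathcal A_n$ such that, for all letters $a,b$ with $ab\in\mathcal L(X^{(n+1)}_{\boldsymbol\tau})$, the word $\tau_n(b)$ begins with $r(a)$ and $\tau_n(a)$ ends with $\ell(b)$. The centered $1$-block presentation $\boldsymbol\tau^{[1]}=(\tau_n^{[1]})_{n\ge0}$ is defined as follows. Its alphabets are $\mathcal A_n^{[1]}=\mathcal L_3(X^{(n)}_{\boldsymbol\tau})$, each word $a_0a_1a_2$ being viewed as a single letter $[a_0a_1a_2]$. For $[a_0a_1a_2]\in\mathcal A_{n+1}^{[1]}$, write $\tau_n(a_0a_1a_2)=b_0b_1\cdots b_{\ell-1}$ with $b_i\in\mathcal A_n$ and put $s=|\tau_n(a_0)|$, $t=|\tau_n(a_1)|$; then $$\tau_n^{[1]}([a_0a_1a_2])=[b_{s-1}b_sb_{s+1}]\,[b_sb_{s+1}b_{s+2}]\cdots[b_{s+t-2}b_{s+t-1}b_{s+t}].$$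
   Formalization: In (2) the alphabets of the centered 1-block presentation are only required to be finite and non-empty, since they may have a single letter: for the constant sequence a↦aa, b↦ab one has L_3(X^(n)) = {aaa}. *)

theory Defs
  imports Complex_Main "HOL-Library.Sublist" "HOL-Library.FuncSet"
begin

definition alphabet :: "'a set \<Rightarrow> bool" where
  "alphabet A \<longleftrightarrow> finite A \<and> card A \<ge> 2"

text \<open>
  A morphism from the free monoid over A to the free monoid over B is represented by the images of
  the letters; its values on letters outside A are irrelevant.
\<close>

definition morph :: "('a \<Rightarrow> 'b list) \<Rightarrow> 'a list \<Rightarrow> 'b list" where
  "morph \<sigma> w = concat (map \<sigma> w)"

definition substitution :: "'a set \<Rightarrow> 'b set \<Rightarrow> ('a \<Rightarrow> 'b list) \<Rightarrow> bool" where
  "substitution A B \<sigma> \<longleftrightarrow>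
     (\<forall>a\<in>A. \<sigma> a \<in> lists B) \<and> (\<forall>a\<in>A. \<sigma> a \<noteq> []) \<and> (\<forall>b\<in>B. \<exists>a\<in>A. b \<in> set (\<sigma> a))"

definition proper :: "'a set \<Rightarrow> 'b set \<Rightarrow> ('a \<Rightarrow> 'b list) \<Rightarrow> bool" where
  "proper A B \<sigma> \<longleftrightarrow> (\<exists>b\<in>B. \<exists>b'\<in>B. \<forall>a\<in>A. prefix [b] (\<sigma> a) \<and> suffix [b'] (\<sigma> a))"

definition factor :: "(int \<Rightarrow> 'a) \<Rightarrow> int \<Rightarrow> nat \<Rightarrow> 'a list" where
  "factor x i k = map (\<lambda>j. x (i + int j)) [0..<k]"

definition language :: "(int \<Rightarrow> 'a) set \<Rightarrow> 'a list set" where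
  "language X = {w. \<exists>x\<in>X. \<exists>i k. w = factor x i k}"

definition language_len :: "nat \<Rightarrow> (int \<Rightarrow> 'a) set \<Rightarrow> 'a list set" where
  "language_len k X = {w \<in> language X. length w = k}"

text \<open>
  Only non-emptiness of the finite alphabets is required here, not the presence of two letters:
  the centered 1-block presentation may have one-letter alphabets even if the original sequence
  does not. For instance, for the constant sequence given by a |-> aa, b |-> ab, the subshift at
  every level is the fixed point of the letter a, so its only factor of length 3 is aaa.
\<close>

definition directive_sequence :: "(nat \<Rightarrow> 'a set) \<Rightarrow> (nat \<Rightarrow> 'a \<Rightarrow> 'a list) \<Rightarrow> bool" where
  "directive_sequence A \<tau> \<longleftrightarrow>
     (\<forall>n. finite (A n) \<and> A n \<noteq> {}) \<and> (\<forall>n. substitution (A (Suc n)) (A n) (\<tau> n))"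

definition proper_sequence :: "(nat \<Rightarrow> 'a set) \<Rightarrow> (nat \<Rightarrow> 'a \<Rightarrow> 'a list) \<Rightarrow> bool" where
  "proper_sequence A \<tau> \<longleftrightarrow> (\<forall>n. proper (A (Suc n)) (A n) (\<tau> n))"

text \<open>
  The composition of the morphisms of index n, ..., m - 1, the one of index m - 1 being applied
  first; it is the identity for m = n.
\<close>

definition compose_range :: "(nat \<Rightarrow> 'a \<Rightarrow> 'a list) \<Rightarrow> nat \<Rightarrow> nat \<Rightarrow> 'a list \<Rightarrow> 'a list" where
  "compose_range \<tau> n m w = foldr (\<lambda>i. morph (\<tau> i)) [n..<m] w"

definition subshift_level ::
  "(nat \<Rightarrow> 'a set) \<Rightarrow> (nat \<Rightarrow> 'a \<Rightarrow> 'a list) \<Rightarrow> nat \<Rightarrow> (int \<Rightarrow> 'a) set" where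
  "subshift_level A \<tau> n =
     {x. range x \<subseteq> A n \<and>
         (\<forall>i k. \<exists>m>n. \<exists>a\<in>A m. sublist (factor x i k) (compose_range \<tau> n m [a]))}"

definition everywhere_growing :: "(nat \<Rightarrow> 'a set) \<Rightarrow> (nat \<Rightarrow> 'a \<Rightarrow> 'a list) \<Rightarrow> bool" where
  "everywhere_growing A \<tau> \<longleftrightarrow>
     filterlim (\<lambda>n. Min ((\<lambda>a. length (compose_range \<tau> 0 n [a])) ` A n)) at_top sequentially"

definition decisive :: "(nat \<Rightarrow> 'a set) \<Rightarrow> (nat \<Rightarrow> 'a \<Rightarrow> 'a list) \<Rightarrow> bool" where
  "decisive A \<tau> \<longleftrightarrow>
     directive_sequence A \<tau> \<and> everywhere_growing A \<tau> \<and>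
     (\<forall>n. \<exists>l \<in> A (Suc n) \<rightarrow> A n. \<exists>r \<in> A (Suc n) \<rightarrow> A n.
        \<forall>a\<in>A (Suc n). \<forall>b\<in>A (Suc n). [a, b] \<in> language (subshift_level A \<tau> (Suc n)) \<longrightarrow>
          prefix [r a] (\<tau> n b) \<and> suffix [l b] (\<tau> n a))"

text \<open>
  The letters of the centered 1-block presentation are the words (lists) of length 3 themselves.
\<close>

definition block_alphabet ::
  "(nat \<Rightarrow> 'a set) \<Rightarrow> (nat \<Rightarrow> 'a \<Rightarrow> 'a list) \<Rightarrow> nat \<Rightarrow> 'a list set" where
  "block_alphabet A \<tau> n = language_len 3 (subshift_level A \<tau> n)"

definition block_subst :: "(nat \<Rightarrow> 'a \<Rightarrow> 'a list) \<Rightarrow> nat \<Rightarrow> 'a list \<Rightarrow> 'a list list" where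
  "block_subst \<tau> n u =
     (let b = morph (\<tau> n) u; s = length (\<tau> n (u ! 0)); t = length (\<tau> n (u ! 1))
      in map (\<lambda>j. [b ! (j - 1), b ! j, b ! (j + 1)]) [s..<s + t])"

end

theory Submission
  imports Defs
begin

text \<open>
  If \<open>\<tau>\<close> is proper, then constant maps \<open>l\<close> and \<open>r\<close>, given by the common last and first letters of
  the images, witness decisiveness.

  For the centered presentation, decisiveness is a matter of overlaps. Consecutive letters in the
  language of the presentation have the form \<open>[a0, a1, a2]\<close>, \<open>[a1, a2, a3]\<close>
  (\<open>block_language_overlap\<close>). The image of the first one ends with the triple formed by the last
  two letters of \<open>\<tau> a1\<close> and the first letter of \<open>\<tau> a2\<close>; the image of the second one begins with
  the triple formed by the last letter of \<open>\<tau> a1\<close> and the first two letters of \<open>\<tau> a2\<close>. They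
  fit because images have length at least 2. Hence both triples depend on \<open>a1 a2\<close> alone, which can
  be read off from either of the two consecutive letters.

  The longer part of the argument shows that the presentation is a directive sequence at all: its
  alphabets are non-empty, and its substitutions map into the right alphabets and cover them. These
  are claims about languages of subshifts. They become statements about finite words through
  \<open>language_subshift_level_iff\<close>: by compactness, a word belongs to the language of level \<open>n\<close> iff it
  has arbitrarily long contexts on both sides inside words \<open>\<tau>\<^sub>n \<cdots> \<tau>\<^sub>m a\<close>. Contexts can be pushed
  forward along a substitution (\<open>morph_language\<close>) and, with a pigeonhole argument, pulled back
  (\<open>block_subst_covers\<close>). Growth is immediate, since images of length at least 2 give lengths of
  at least \<open>2 ^ n\<close> after \<open>n\<close> steps, for \<open>\<tau>\<close> as well as for the presentation.
\<close>

section \<open>Compositions of the substitutions\<close>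

lemma morph_Nil [simp]: "morph \<sigma> [] = []"
  and morph_Cons [simp]: "morph \<sigma> (a # w) = \<sigma> a @ morph \<sigma> w"
  and morph_append [simp]: "morph \<sigma> (v @ w) = morph \<sigma> v @ morph \<sigma> w"
  by (simp_all add: morph_def)

lemma morph_in_lists:
  assumes "\<And>a. a \<in> A \<Longrightarrow> \<sigma> a \<in> lists B" and "w \<in> lists A"
  shows "morph \<sigma> w \<in> lists B"
  using assms(2) by (induction w) (auto dest: assms(1))

lemma length_morph_ge:
  assumes "\<And>a. a \<in> A \<Longrightarrow> c \<le> length (\<sigma> a)" and "w \<in> lists A"
  shows "c * length w \<le> length (morph \<sigma> w)"
  using assms(2) by (induction w) (auto dest: assms(1) intro: add_mono)

lemma length_morph_le:
  assumes "\<And>a. a \<in> A \<Longrightarrow> length (\<sigma> a) \<le> c" and "w \<in> lists A"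
  shows "length (morph \<sigma> w) \<le> c * length w"
  using assms(2) by (induction w) (auto dest: assms(1) intro: add_mono)

lemma morph_split_at_letter:
  assumes "morph \<sigma> v = P @ c # S"
  shows "\<exists>v1 a v2 p s. v = v1 @ a # v2 \<and> \<sigma> a = p @ c # s \<and>
           P = morph \<sigma> v1 @ p \<and> S = s @ morph \<sigma> v2"
  using assms
proof (induction v arbitrary: P)
  case Nil
  then show ?case by simp
next
  case (Cons a v)
  from Cons.prems have "\<sigma> a @ morph \<sigma> v = P @ c # S" by simp
  then consider (later) us where "P = \<sigma> a @ us" "morph \<sigma> v = us @ c # S"
    | (here) us where "\<sigma> a = P @ c # us" "S = us @ morph \<sigma> v"
  proof -
    obtain us where "\<sigma> a = P @ us \<and> us @ morph \<sigma> v = c # S \<or>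
        \<sigma> a @ us = P \<and> morph \<sigma> v = us @ c # S"
      using \<open>\<sigma> a @ morph \<sigma> v = P @ c # S\<close> by (auto simp: append_eq_append_conv2)
    then show thesis using that by (cases us) auto
  qed
  then show ?case
  proof cases
    case later
    from Cons.IH[OF later(2)] obtain v1 a' v2 p s where
      "v = v1 @ a' # v2" "\<sigma> a' = p @ c # s" "us = morph \<sigma> v1 @ p" "S = s @ morph \<sigma> v2"
      by blast
    then have "a # v = (a # v1) @ a' # v2 \<and> \<sigma> a' = p @ c # s \<and>
           P = morph \<sigma> (a # v1) @ p \<and> S = s @ morph \<sigma> v2" using later(1) by simp
    then show ?thesis by blast
  next
    case here
    then have "a # v = [] @ a # v \<and> \<sigma> a = P @ c # us \<and>
           P = morph \<sigma> [] @ P \<and> S = us @ morph \<sigma> v" by simp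
    then show ?thesis by blast
  qed
qed

lemma compose_range_refl [simp]: "compose_range \<tau> n n w = w"
  by (simp add: compose_range_def)

lemma compose_range_step:
  "n < m \<Longrightarrow> compose_range \<tau> n m w = morph (\<tau> n) (compose_range \<tau> (Suc n) m w)"
  by (simp add: compose_range_def upt_conv_Cons)

lemma directive_sequence_image:
  "directive_sequence A \<tau> \<Longrightarrow> a \<in> A (Suc n) \<Longrightarrow> \<tau> n a \<in> lists (A n)"
  by (auto simp: directive_sequence_def substitution_def)

lemma compose_range_in_lists:
  assumes "directive_sequence A \<tau>" and "n \<le> m" and "w \<in> lists (A m)"
  shows "compose_range \<tau> n m w \<in> lists (A n)"
  using assms(2)
proof (induction rule: inc_induct)
  case base
  show ?case using assms(3) by simp
next
  case (step k)
  have "morph (\<tau> k) (compose_range \<tau> (Suc k) m w) \<in> lists (A k)"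
    by (rule morph_in_lists[OF _ step.IH]) (rule directive_sequence_image[OF assms(1)])
  then show ?case using step.hyps by (simp add: compose_range_step)
qed

lemma length_compose_range_ge:
  assumes dir: "directive_sequence A \<tau>"
    and two: "\<And>n a. a \<in> A (Suc n) \<Longrightarrow> 2 \<le> length (\<tau> n a)"
    and "n \<le> m" and w: "w \<in> lists (A m)"
  shows "2 ^ (m - n) * length w \<le> length (compose_range \<tau> n m w)"
  using assms(3)
proof (induction rule: inc_induct)
  case base
  show ?case by simp
next
  case (step k)
  have "compose_range \<tau> (Suc k) m w \<in> lists (A (Suc k))"
    using dir w step.hyps by (intro compose_range_in_lists) auto
  from length_morph_ge[OF two this]
  have "2 * length (compose_range \<tau> (Suc k) m w) \<le> length (compose_range \<tau> k m w)"
    using step.hyps by (simp add: compose_range_step)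
  moreover have "(2::nat) ^ (m - k) = 2 * 2 ^ (m - Suc k)"
    using step.hyps by (metis Suc_diff_Suc power_Suc)
  ultimately show ?case using step.IH by simp
qed

lemma everywhere_growing_if_images_ge_2:
  assumes dir: "directive_sequence A \<tau>"
    and two: "\<And>n a. a \<in> A (Suc n) \<Longrightarrow> 2 \<le> length (\<tau> n a)"
  shows "everywhere_growing A \<tau>"
proof -
  have "n \<le> Min ((\<lambda>a. length (compose_range \<tau> 0 n [a])) ` A n)" for n
  proof (rule Min.boundedI)
    show "finite ((\<lambda>a. length (compose_range \<tau> 0 n [a])) ` A n)"
      and "(\<lambda>a. length (compose_range \<tau> 0 n [a])) ` A n \<noteq> {}"
      using dir by (auto simp: directive_sequence_def)
    fix k assume "k \<in> (\<lambda>a. length (compose_range \<tau> 0 n [a])) ` A n"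
    then obtain a where a: "a \<in> A n" "k = length (compose_range \<tau> 0 n [a])" by blast
    have "2 ^ n \<le> k"
      using length_compose_range_ge[OF dir two, of 0 n "[a]"] a by simp
    then show "n \<le> k" using less_exp[of n] by linarith
  qed
  then show ?thesis
    unfolding everywhere_growing_def
    by (intro filterlim_at_top_mono[OF filterlim_ident]) simp
qed

section \<open>Languages and two-sided extendability\<close>

definition generated :: "(nat \<Rightarrow> 'a set) \<Rightarrow> (nat \<Rightarrow> 'a \<Rightarrow> 'a list) \<Rightarrow> nat \<Rightarrow> 'a list set" where
  "generated A \<tau> n = {w. \<exists>m>n. \<exists>a\<in>A m. sublist w (compose_range \<tau> n m [a])}"

text \<open>
  The context has to reach arbitrarily far on both sides, inside a single word of \<open>F\<close> for each
  required length; the words for different lengths need not be compatible.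
\<close>

definition extendable :: "'a list set \<Rightarrow> 'a list \<Rightarrow> bool" where
  "extendable F w \<longleftrightarrow> (\<forall>k. \<exists>p s. k \<le> length p \<and> k \<le> length s \<and> p @ w @ s \<in> F)"

lemma mem_subshift_level_iff:
  "x \<in> subshift_level A \<tau> n \<longleftrightarrow> range x \<subseteq> A n \<and> (\<forall>i k. factor x i k \<in> generated A \<tau> n)"
  by (simp add: subshift_level_def generated_def)

lemma generated_sublist:
  "w \<in> generated A \<tau> n \<Longrightarrow> sublist v w \<Longrightarrow> v \<in> generated A \<tau> n"
  unfolding generated_def using sublist_order.order.trans by blast

lemma generated_in_lists:
  assumes "directive_sequence A \<tau>"
  shows "generated A \<tau> n \<subseteq> lists (A n)"
proof
  fix w assume "w \<in> generated A \<tau> n"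
  then obtain m a where m: "m > n" "a \<in> A m" "sublist w (compose_range \<tau> n m [a])"
    by (auto simp: generated_def)
  have "compose_range \<tau> n m [a] \<in> lists (A n)"
    using m by (intro compose_range_in_lists[OF assms]) auto
  then show "w \<in> lists (A n)" using set_mono_sublist[OF m(3)] by auto
qed

lemma generated_morph:
  assumes "w \<in> generated A \<tau> (Suc n)"
  shows "morph (\<tau> n) w \<in> generated A \<tau> n"
proof -
  from assms obtain m a p s where m: "m > Suc n" "a \<in> A m"
    and eq: "compose_range \<tau> (Suc n) m [a] = p @ w @ s"
    by (auto simp: generated_def sublist_def)
  have "compose_range \<tau> n m [a] = morph (\<tau> n) p @ morph (\<tau> n) w @ morph (\<tau> n) s"
    using m eq by (simp add: compose_range_step)
  then show ?thesis using m by (auto simp: generated_def sublist_def intro!: exI[of _ m])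
qed

lemma pigeonhole_antitone:
  fixes P :: "'i \<Rightarrow> nat \<Rightarrow> bool"
  assumes "finite I" and "\<And>k. \<exists>i\<in>I. P i k" and "\<And>i k l. k \<le> l \<Longrightarrow> P i l \<Longrightarrow> P i k"
  shows "\<exists>i\<in>I. \<forall>k. P i k"
proof (rule ccontr)
  assume "\<not> ?thesis"
  then obtain K where K: "\<And>i. i \<in> I \<Longrightarrow> \<not> P i (K i)" by metis
  obtain i where i: "i \<in> I" "P i (Max (K ` I))" using assms(2) by blast
  moreover have "K i \<le> Max (K ` I)" using assms(1) i by simp
  ultimately show False using assms(3) K by blast
qed

text \<open>
  Extending by one letter on each side leaves only finitely many possibilities, so one of them
  works for unboundedly many, hence all, lengths of the remaining extension.
\<close>

lemma extendable_step:
  assumes fin: "finite A" and FA: "F \<subseteq> lists A"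
    and w: "extendable F w"
  shows "\<exists>a b. extendable F (a # w @ [b])"
proof -
  define P where "P i k \<longleftrightarrow> (\<exists>p s. k \<le> length p \<and> k \<le> length s \<and> p @ (fst i # w @ [snd i]) @ s \<in> F)"
    for i k
  have "\<exists>i\<in>A \<times> A. \<forall>k. P i k"
  proof (rule pigeonhole_antitone)
    show "finite (A \<times> A)" using fin by simp
    show "\<And>i k l. k \<le> l \<Longrightarrow> P i l \<Longrightarrow> P i k" unfolding P_def by (meson le_trans)
    fix k
    from w obtain p s where ps: "Suc k \<le> length p" "Suc k \<le> length s" "p @ w @ s \<in> F"
      unfolding extendable_def by blast
    from ps obtain p' a where p: "p = p' @ [a]" by (cases p rule: rev_cases) auto
    from ps obtain b s' where s: "s = b # s'" by (cases s) auto
    from ps p s have "p' @ (a # w @ [b]) @ s' \<in> F" by simp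
    moreover from this have "a \<in> A" "b \<in> A" using FA by auto
    ultimately show "\<exists>i\<in>A \<times> A. P i k" using ps p s unfolding P_def by fastforce
  qed
  then show ?thesis unfolding P_def extendable_def by auto
qed

lemma length_factor [simp]: "length (factor x i k) = k"
  by (simp add: factor_def)

lemma factor_append: "factor x i k @ factor x (i + int k) l = factor x i (k + l)"
  by (rule nth_equalityI) (auto simp: factor_def nth_append algebra_simps of_nat_diff)

text \<open>
  Iterating the one-letter extension gives a growing sequence of words, each a centred factor of
  the next; they converge to the bi-infinite word. This is Koenig's lemma, with the
  index \<open>i\<close> of the limit read off from any sufficiently late word of the sequence.
\<close>

lemma extendable_imp_bi_infinite:
  assumes fin: "finite A" and FA: "F \<subseteq> lists A"
    and sub: "\<And>v w. w \<in> F \<Longrightarrow> sublist v w \<Longrightarrow> v \<in> F"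
    and w: "extendable F w"
  shows "\<exists>x. (\<forall>i k. factor x i k \<in> F) \<and> factor x 0 (length w) = w"
proof -
  have "\<exists>f. \<forall>n. (extendable F (f n) \<and> (n = 0 \<longrightarrow> f n = w)) \<and>
            (\<exists>a b. f (Suc n) = a # f n @ [b])"
  proof (rule dependent_nat_choice)
    show "\<exists>v. extendable F v \<and> (0 = 0 \<longrightarrow> v = w)" using w by blast
    fix v and n :: nat
    assume "extendable F v \<and> (n = 0 \<longrightarrow> v = w)"
    then show "\<exists>v'. (extendable F v' \<and> (Suc n = 0 \<longrightarrow> v' = w)) \<and> (\<exists>a b. v' = a # v @ [b])"
      using extendable_step[OF fin FA] by blast
  qed
  then obtain f where ext: "\<And>n. extendable F (f n)" and f0: "f 0 = w"
    and f_Suc: "\<And>n. \<exists>a b. f (Suc n) = a # f n @ [b]" by blast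
  have len: "length (f n) = length w + 2 * n" for n
  proof (induction n)
    case (Suc n)
    then show ?case using f_Suc[of n] by auto
  qed (simp add: f0)
  have shift: "f (n + d) ! (j + d) = f n ! j" if "j < length (f n)" for n d j
  proof (induction d)
    case (Suc d)
    obtain a b where "f (Suc (n + d)) = a # f (n + d) @ [b]" using f_Suc by blast
    then have "f (n + Suc d) ! (j + Suc d) = (f (n + d) @ [b]) ! (j + d)" by simp
    also have "\<dots> = f (n + d) ! (j + d)" using that by (simp add: nth_append len)
    finally show ?case using Suc by simp
  qed simp
  define x where "x i = f (Suc (nat \<bar>i\<bar>)) ! nat (i + int (Suc (nat \<bar>i\<bar>)))" for i :: int
  have x_eq: "x i = f N ! nat (i + int N)" if N: "Suc (nat \<bar>i\<bar>) \<le> N" for i N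
  proof -
    define M where "M = Suc (nat \<bar>i\<bar>)"
    obtain d where d: "N = M + d" using le_Suc_ex[OF N] unfolding M_def by blast
    have "int M = \<bar>i\<bar> + 1" by (simp add: M_def)
    then have "nat (i + int M) < length (f M)" unfolding len by linarith
    from shift[OF this, of d] have "f N ! (nat (i + int M) + d) = f M ! nat (i + int M)"
      by (simp add: d)
    moreover have "nat (i + int M) + d = nat (i + int N)" unfolding d M_def by linarith
    ultimately show ?thesis unfolding x_def M_def by simp
  qed
  have "factor x i k \<in> F" for i k
  proof -
    define N where "N = Suc (nat \<bar>i\<bar> + k)"
    have "factor x i k = take k (drop (nat (i + int N)) (f N))" (is "_ = ?rhs")
    proof (rule nth_equalityI)
      have "int N = \<bar>i\<bar> + int k + 1" by (simp add: N_def)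
      then have le: "nat (i + int N) + k \<le> length (f N)" unfolding len by linarith
      then show "length (factor x i k) = length ?rhs" by simp
      fix j assume "j < length (factor x i k)"
      then have j: "j < k" by simp
      have "factor x i k ! j = x (i + int j)" using j by (simp add: factor_def)
      also have "\<dots> = f N ! nat (i + int j + int N)"
        by (rule x_eq) (use j in \<open>simp add: N_def\<close>)
      also have "nat (i + int j + int N) = nat (i + int N) + j" unfolding N_def by linarith
      finally show "factor x i k ! j = ?rhs ! j" using j le by simp
    qed
    moreover obtain p s where "p @ f N @ s \<in> F" using ext[of N] unfolding extendable_def by blast
    moreover have "sublist ?rhs (f N)"
      using sublist_take sublist_drop sublist_order.order.trans by blast
    moreover have "sublist (f N) (p @ f N @ s)" by (simp add: sublist_appendI)
    ultimately show ?thesis using sub by metis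
  qed
  moreover have "factor x 0 (length w) = w"
  proof (rule nth_equalityI)
    fix j assume "j < length (factor x 0 (length w))"
    then have j: "j < length w" by simp
    have "x (int j) = f (Suc j) ! nat (int j + int (Suc j))" by (rule x_eq) simp
    also have "nat (int j + int (Suc j)) = j + Suc j" by linarith
    also have "f (Suc j) ! (j + Suc j) = w ! j" using shift[of j 0 "Suc j"] j by (simp add: f0)
    finally show "factor x 0 (length w) ! j = w ! j" using j by (simp add: factor_def)
  qed simp
  ultimately show ?thesis by blast
qed

text \<open>
  Compactness turns arbitrarily long contexts into a point of the subshift. The criterion speaks of
  finite words only, so that it can be transported along substitutions.
\<close>

lemma language_subshift_level_iff:
  assumes dir: "directive_sequence A \<tau>"
  shows "w \<in> language (subshift_level A \<tau> n) \<longleftrightarrow> extendable (generated A \<tau> n) w"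
proof
  assume "w \<in> language (subshift_level A \<tau> n)"
  then obtain x i k where x: "x \<in> subshift_level A \<tau> n" and w: "w = factor x i k"
    by (auto simp: language_def)
  have "factor x (i - int l) l @ w @ factor x (i + int k) l \<in> generated A \<tau> n" for l
  proof -
    have "factor x (i - int l) l @ w @ factor x (i + int k) l = factor x (i - int l) (l + (k + l))"
      using factor_append[of x "i - int l" l "k + l"] factor_append[of x i k l] w by simp
    then show ?thesis using x by (simp add: mem_subshift_level_iff)
  qed
  then show "extendable (generated A \<tau> n) w"
    unfolding extendable_def by (metis length_factor order_refl)
next
  assume ext: "extendable (generated A \<tau> n) w"
  have fin: "finite (A n)" using dir by (simp add: directive_sequence_def)
  obtain x where x: "\<And>i k. factor x i k \<in> generated A \<tau> n"
    and w: "factor x 0 (length w) = w"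
    using extendable_imp_bi_infinite[OF fin generated_in_lists[OF dir] _ ext] generated_sublist
    by blast
  have "x i \<in> A n" for i
    using x[of i 1] generated_in_lists[OF dir, of n] by (auto simp: factor_def)
  then have "x \<in> subshift_level A \<tau> n" using x by (auto simp: mem_subshift_level_iff)
  then show "w \<in> language (subshift_level A \<tau> n)" unfolding language_def using w[symmetric] by blast
qed

lemma language_sublist:
  assumes "w \<in> language X" and "sublist v w"
  shows "v \<in> language X"
proof -
  from assms obtain x i k p s where x: "x \<in> X" and pvs: "p @ v @ s = factor x i k"
    by (auto simp: language_def sublist_def)
  have k: "k = length p + (length v + length s)"
    using arg_cong[OF pvs, of length] by simp
  then have "p @ v @ s = factor x i (length p) @ factor x (i + int (length p)) (length v) @
      factor x (i + int (length p) + int (length v)) (length s)"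
    using pvs unfolding k by (simp only: factor_append)
  then have "v = factor x (i + int (length p)) (length v)" by simp
  then show ?thesis using x unfolding language_def by blast
qed

lemma language_in_lists: "language (subshift_level A \<tau> n) \<subseteq> lists (A n)"
  by (auto simp: language_def subshift_level_def factor_def image_subset_iff)

lemma morph_language:
  assumes dir: "directive_sequence A \<tau>"
    and w: "w \<in> language (subshift_level A \<tau> (Suc n))"
  shows "morph (\<tau> n) w \<in> language (subshift_level A \<tau> n)"
  unfolding language_subshift_level_iff[OF dir] extendable_def
proof
  fix k
  from w obtain p s where ps: "k \<le> length p" "k \<le> length s" "p @ w @ s \<in> generated A \<tau> (Suc n)"
    unfolding language_subshift_level_iff[OF dir] extendable_def by blast
  have ge: "1 * length v \<le> length (morph (\<tau> n) v)" if "v \<in> lists (A (Suc n))" for v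
    using that by (intro length_morph_ge)
      (use dir in \<open>auto simp: directive_sequence_def substitution_def Suc_le_eq\<close>)
  have "p \<in> lists (A (Suc n))" "s \<in> lists (A (Suc n))"
    using ps(3) generated_in_lists[OF dir, of "Suc n"] by auto
  then have "k \<le> length (morph (\<tau> n) p)" "k \<le> length (morph (\<tau> n) s)"
    using ge ps by fastforce+
  then show "\<exists>p s. k \<le> length p \<and> k \<le> length s \<and> p @ morph (\<tau> n) w @ s \<in> generated A \<tau> n"
    using generated_morph[OF ps(3)] by auto
qed

lemma Nil_in_language:
  assumes dir: "directive_sequence A \<tau>"
    and two: "\<And>n a. a \<in> A (Suc n) \<Longrightarrow> 2 \<le> length (\<tau> n a)"
  shows "[] \<in> language (subshift_level A \<tau> n)"
  unfolding language_subshift_level_iff[OF dir] extendable_def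
proof
  fix k
  \<comment> \<open>Letters of level \<open>m\<close> give words of level \<open>n\<close> of length at least \<open>2 ^ (m - n)\<close>; cut one at \<open>k\<close>.\<close>
  define m where "m = n + Suc (2 * k)"
  obtain a where a: "a \<in> A m" using dir unfolding directive_sequence_def by blast
  define v where "v = compose_range \<tau> n m [a]"
  have "2 ^ Suc (2 * k) \<le> length v"
    using length_compose_range_ge[OF dir two, of n m "[a]"] a by (simp add: v_def m_def)
  then have "2 * k \<le> length v" using less_exp[of "Suc (2 * k)"] by linarith
  moreover have "v \<in> generated A \<tau> n"
    unfolding generated_def v_def using a by (auto simp: m_def intro!: exI[of _ m])
  ultimately show "\<exists>p s. k \<le> length p \<and> k \<le> length s \<and> p @ [] @ s \<in> generated A \<tau> n"
    by (intro exI[of _ "take k v"] exI[of _ "drop k v"]) auto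
qed

section \<open>The substitutions of the centered presentation\<close>

fun triples :: "'a list \<Rightarrow> 'a list list" where
  "triples (a # b # c # w) = [a, b, c] # triples (b # c # w)"
| "triples _ = []"

lemma triples_conv_nth:
  "triples w = map (\<lambda>j. [w ! j, w ! (j + 1), w ! (j + 2)]) [0..<length w - 2]"
proof (induction w rule: triples.induct)
  case (1 a b c w)
  have "[0..<length (a # b # c # w) - 2] = 0 # map Suc [0..<length (b # c # w) - 2]"
    by (simp add: upt_conv_Cons map_Suc_upt del: upt_Suc)
  then show ?case using 1 by (simp add: comp_def del: upt_Suc)
qed simp_all

lemma length_triples: "length (triples w) = length w - 2"
  by (simp add: triples_conv_nth)

lemma triples_append_conv: "triples (p @ a # b # w) = triples (p @ [a, b]) @ triples (a # b # w)"
  by (induction p rule: triples.induct) auto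

lemma sublist_triples: "v \<in> set (triples w) \<Longrightarrow> length v = 3 \<and> sublist v w"
  by (induction w rule: triples.induct) (auto intro: sublist_order.order.trans simp: sublist_Cons_right)

lemma last_triples: "last (triples (w @ [a, b, c])) = [a, b, c]"
  using triples_append_conv[of w a b "[c]"] by simp

lemma mem_triples: "[a, b, c] \<in> set (triples (p @ a # b # c # s))"
  using triples_append_conv[of p a b "c # s"] by simp

lemma successively_triples: "successively (\<lambda>u v. tl u = butlast v) (triples w)"
proof (induction w rule: triples.induct)
  case (1 a b c w)
  then show ?case by (cases w) simp_all
qed simp_all

text \<open>
  The window read by \<open>block_subst\<close> consists of the image of the middle letter and one
  neighbouring letter on each side.
\<close>

lemma block_subst_conv_triples:
  assumes "\<tau> n a0 \<noteq> []" and "\<tau> n a2 \<noteq> []"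
  shows "block_subst \<tau> n [a0, a1, a2] = triples (last (\<tau> n a0) # \<tau> n a1 @ [hd (\<tau> n a2)])"
proof -
  from assms obtain p x y s where p: "\<tau> n a0 = p @ [x]" and s: "\<tau> n a2 = y # s"
    by (metis rev_exhaust list.exhaust)
  define z where "z = x # \<tau> n a1 @ [y]"
  have morph_eq: "morph (\<tau> n) [a0, a1, a2] = p @ z @ s" by (simp add: p s z_def)
  have shift: "(p @ z @ s) ! (length p + i) = z ! i" if "i < length z" for i
    using that by (simp add: nth_append)
  have "block_subst \<tau> n [a0, a1, a2] = map (\<lambda>j. [z ! j, z ! (j + 1), z ! (j + 2)]) [0..<length z - 2]"
    unfolding block_subst_def Let_def morph_eq
  proof (rule nth_equalityI, goal_cases)
    case 1
    show ?case by (simp add: p z_def del: upt_Suc)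
  next
    case (2 j)
    then have j: "j < length (\<tau> n a1)" by simp
    then have "Suc (Suc j) < length z" "j < length z - 2" by (simp_all add: z_def)
    with j show ?case using shift[of j] shift[of "Suc j"] shift[of "Suc (Suc j)"] by (simp add: p del: upt_Suc)
  qed
  also have "\<dots> = triples z" by (simp add: triples_conv_nth)
  finally show ?thesis by (simp add: z_def p s)
qed

lemma hd_block_subst:
  assumes "\<tau> n a0 \<noteq> []" and "2 \<le> length (\<tau> n a1)" and "\<tau> n a2 \<noteq> []"
  shows "hd (block_subst \<tau> n [a0, a1, a2]) = [last (\<tau> n a0), hd (\<tau> n a1), hd (tl (\<tau> n a1))]"
proof -
  from assms(2) obtain x y w where "\<tau> n a1 = x # y # w"
    by (metis Suc_le_length_iff numeral_2_eq_2)
  then show ?thesis using assms by (simp add: block_subst_conv_triples)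
qed

lemma last_block_subst:
  assumes "\<tau> n a0 \<noteq> []" and "2 \<le> length (\<tau> n a1)" and "\<tau> n a2 \<noteq> []"
  shows "last (block_subst \<tau> n [a0, a1, a2]) =
           [last (butlast (\<tau> n a1)), last (\<tau> n a1), hd (\<tau> n a2)]"
proof -
  obtain w x y where "\<tau> n a1 = w @ [x, y]"
    using assms(2) by (cases "\<tau> n a1" rule: rev_cases; cases "butlast (\<tau> n a1)" rule: rev_cases) auto
  then show ?thesis
    using assms last_triples[of "last (\<tau> n a0) # w" x y "hd (\<tau> n a2)"]
    by (simp add: block_subst_conv_triples butlast_append)
qed

lemma length_block_subst:
  assumes "\<tau> n a0 \<noteq> []" and "\<tau> n a2 \<noteq> []"
  shows "length (block_subst \<tau> n [a0, a1, a2]) = length (\<tau> n a1)"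
  using assms by (simp add: block_subst_conv_triples length_triples)

lemma block_alphabet_cases:
  assumes "u \<in> block_alphabet A \<tau> n"
  obtains a0 a1 a2 where "u = [a0, a1, a2]" "a0 \<in> A n" "a1 \<in> A n" "a2 \<in> A n"
proof -
  have "u \<in> lists (A n)" "length u = 3"
    using assms language_in_lists[of A \<tau> n] by (auto simp: block_alphabet_def language_len_def)
  then show thesis using that by (auto simp: numeral_3_eq_3 length_Suc_conv)
qed

text \<open>
  Desubstitution: a triple in the language of level \<open>n\<close> lies deep inside images of words of
  level \<open>n + 1\<close>. The letter whose image contains the middle of the triple then has a long
  context on both sides, since a long image requires a long word. There are finitely many choices
  for that letter with its two neighbours, so one of them has arbitrarily long contexts and
  belongs to the language.
\<close>

lemma block_subst_covers:
  assumes dir: "directive_sequence A \<tau>"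
    and w: "w \<in> block_alphabet A \<tau> n"
  shows "\<exists>u\<in>block_alphabet A \<tau> (Suc n). w \<in> set (block_subst \<tau> n u)"
proof -
  obtain b0 b1 b2 where w_eq: "w = [b0, b1, b2]" using w by (rule block_alphabet_cases)
  have ext: "extendable (generated A \<tau> n) w"
    using w by (simp add: block_alphabet_def language_len_def language_subshift_level_iff[OF dir])
  have fin: "finite (A (Suc n))" using dir by (simp add: directive_sequence_def)
  have ne: "\<tau> n a \<noteq> []" if "a \<in> A (Suc n)" for a
    using dir that by (auto simp: directive_sequence_def substitution_def)
  define M where "M = Max ((\<lambda>a. length (\<tau> n a)) ` A (Suc n))"
  have M: "length (\<tau> n a) \<le> M" if "a \<in> A (Suc n)" for a
    unfolding M_def using fin that by simp
  define U where "U = {u. set u \<subseteq> A (Suc n) \<and> length u = 3 \<and> w \<in> set (block_subst \<tau> n u)}"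
  define P where "P = (\<lambda>u k. \<exists>p s. k \<le> length p \<and> k \<le> length s \<and> p @ u @ s \<in> generated A \<tau> (Suc n))"
  have "\<exists>u\<in>U. \<forall>k. P u k"
  proof (rule pigeonhole_antitone)
    show "finite U"
      by (rule finite_subset[OF _ finite_lists_length_eq[OF fin, of 3]]) (auto simp: U_def)
    show "\<And>i k l. k \<le> l \<Longrightarrow> P i l \<Longrightarrow> P i k" unfolding P_def by (meson le_trans)
    fix k
    \<comment> \<open>Even after the removal of a part of length less than \<open>M\<close>, which lies in the image of the
      central letter, a context longer than this is covered only by more than \<open>k + 1\<close> letters.\<close>
    define K where "K = M * (k + 2)"
    from ext obtain p s where ps: "K \<le> length p" "K \<le> length s" "p @ w @ s \<in> generated A \<tau> n"
      unfolding extendable_def by blast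
    then obtain m a p' s' where m: "n < m" "a \<in> A m"
      and eq: "compose_range \<tau> n m [a] = p' @ (p @ w @ s) @ s'"
      by (auto simp: generated_def sublist_def)
    define v where "v = compose_range \<tau> (Suc n) m [a]"
    have v: "v \<in> lists (A (Suc n))"
      unfolding v_def using m by (intro compose_range_in_lists[OF dir]) auto
    have "morph (\<tau> n) v = (p' @ p @ [b0]) @ b1 # (b2 # s @ s')"
      using eq m by (simp add: v_def w_eq compose_range_step)
    from morph_split_at_letter[OF this] obtain v1 a1 v2 q t where
      split: "v = v1 @ a1 # v2" "\<tau> n a1 = q @ b1 # t"
      and left: "p' @ p @ [b0] = morph (\<tau> n) v1 @ q" and right: "b2 # s @ s' = t @ morph (\<tau> n) v2"
      by blast
    have in_A: "a1 \<in> A (Suc n)" "v1 \<in> lists (A (Suc n))" "v2 \<in> lists (A (Suc n))"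
      using v split by auto
    have len: "length (morph (\<tau> n) x) \<le> M * length x" if "x \<in> lists (A (Suc n))" for x
      using that by (intro length_morph_le) (auto intro: M)
    have "length q < M" "length t < M" using M[OF in_A(1)] split(2) by auto
    moreover have "K + 1 \<le> length (morph (\<tau> n) v1) + length q"
      using arg_cong[OF left, of length] ps by simp
    moreover have "K + 1 \<le> length t + length (morph (\<tau> n) v2)"
      using arg_cong[OF right, of length] ps by simp
    ultimately have "M * (k + 1) < M * length v1" "M * (k + 1) < M * length v2"
      using len[OF in_A(2)] len[OF in_A(3)] by (auto simp: K_def)
    then have long: "k + 1 < length v1" "k + 1 < length v2" by (simp_all only: mult_less_cancel1)
    obtain v1' a0 where v1: "v1 = v1' @ [a0]" using long by (cases v1 rule: rev_cases) auto
    obtain a2 v2' where v2: "v2 = a2 # v2'" using long by (cases v2) auto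
    have ne0: "\<tau> n a0 \<noteq> []" and ne2: "\<tau> n a2 \<noteq> []" using ne in_A v1 v2 by auto
    \<comment> \<open>For \<open>m = Suc n\<close>, \<open>v\<close> would be a single letter and leave no room for contexts.\<close>
    have "m > Suc n"
    proof (rule ccontr)
      assume "\<not> m > Suc n"
      then have "m = Suc n" using m by simp
      then have "v = [a]" by (simp add: v_def)
      then show False using arg_cong[OF split(1), of length] long by simp
    qed
    then have "v \<in> generated A \<tau> (Suc n)"
      unfolding generated_def v_def using m by blast
    then have "P [a0, a1, a2] k"
      unfolding P_def using long v1 v2 split(1)
      by (intro exI[of _ v1'] exI[of _ v2']) auto
    moreover have "w \<in> set (block_subst \<tau> n [a0, a1, a2])"
    proof -
      have "last (p' @ p @ [b0]) = last (morph (\<tau> n) v1' @ \<tau> n a0 @ q)" using left v1 by simp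
      then have "b0 = last (last (\<tau> n a0) # q)" using ne0 by (simp add: last_append)
      then obtain l where l: "last (\<tau> n a0) # q = l @ [b0]"
        by (metis append_butlast_last_id list.distinct(1))
      have "hd (b2 # s @ s') = hd (t @ \<tau> n a2 @ morph (\<tau> n) v2')" using right v2 by simp
      then have "b2 = hd (t @ [hd (\<tau> n a2)])" using ne2 by (simp add: hd_append)
      then obtain r where r: "t @ [hd (\<tau> n a2)] = b2 # r"
        by (cases t) auto
      have "last (\<tau> n a0) # \<tau> n a1 @ [hd (\<tau> n a2)] = l @ b0 # b1 # b2 # r"
        using l r split(2) by simp
      then show ?thesis
        using mem_triples[of b0 b1 b2 l r] ne0 ne2 by (simp add: block_subst_conv_triples w_eq)
    qed
    ultimately show "\<exists>u\<in>U. P u k"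
      using in_A v1 v2 unfolding U_def by (intro bexI[of _ "[a0, a1, a2]"]) auto
  qed
  then obtain u where u: "u \<in> U" "\<And>k. P u k" by blast
  then have "u \<in> block_alphabet A \<tau> (Suc n)"
    by (simp add: U_def P_def block_alphabet_def language_len_def extendable_def
        language_subshift_level_iff[OF dir])
  then show ?thesis using u by (auto simp: U_def)
qed

lemma directive_sequence_block:
  assumes dir: "directive_sequence A \<tau>"
    and two: "\<And>n a. a \<in> A (Suc n) \<Longrightarrow> 2 \<le> length (\<tau> n a)"
  shows "directive_sequence (block_alphabet A \<tau>) (block_subst \<tau>)"
  unfolding directive_sequence_def substitution_def
proof (intro conjI allI ballI)
  fix n
  have "finite (A n)" using dir by (simp add: directive_sequence_def)
  then have "finite {u. set u \<subseteq> A n \<and> length u = 3}" by (rule finite_lists_length_eq)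
  moreover have "block_alphabet A \<tau> n \<subseteq> {u. set u \<subseteq> A n \<and> length u = 3}"
    by (auto elim: block_alphabet_cases)
  ultimately show "finite (block_alphabet A \<tau> n)" by (rule rev_finite_subset)
  obtain x where "x \<in> subshift_level A \<tau> n"
    using Nil_in_language[OF dir two] by (auto simp: language_def)
  then have "factor x 0 3 \<in> block_alphabet A \<tau> n"
    by (auto simp: block_alphabet_def language_len_def language_def)
  then show "block_alphabet A \<tau> n \<noteq> {}" by blast
next
  fix n u assume u: "u \<in> block_alphabet A \<tau> (Suc n)"
  then obtain a0 a1 a2 where u_eq: "u = [a0, a1, a2]"
    and a: "a0 \<in> A (Suc n)" "a1 \<in> A (Suc n)" "a2 \<in> A (Suc n)" by (rule block_alphabet_cases)
  have ne: "\<tau> n a0 \<noteq> []" "\<tau> n a1 \<noteq> []" "\<tau> n a2 \<noteq> []" using two a by fastforce+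
  show "block_subst \<tau> n u \<noteq> []" using length_block_subst[of \<tau> n a0 a2 a1] ne u_eq by auto
  define z where "z = last (\<tau> n a0) # \<tau> n a1 @ [hd (\<tau> n a2)]"
  have "morph (\<tau> n) u = butlast (\<tau> n a0) @ z @ tl (\<tau> n a2)" using ne by (simp add: u_eq z_def)
  then have "sublist z (morph (\<tau> n) u)" by (simp add: sublist_appendI)
  moreover have "morph (\<tau> n) u \<in> language (subshift_level A \<tau> n)"
    using u by (intro morph_language[OF dir]) (simp add: block_alphabet_def language_len_def)
  ultimately have z: "z \<in> language (subshift_level A \<tau> n)" by (metis language_sublist)
  show "block_subst \<tau> n u \<in> lists (block_alphabet A \<tau> n)"
    using sublist_triples[of _ z] language_sublist[OF z] ne
    by (auto simp: u_eq block_subst_conv_triples block_alphabet_def language_len_def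
        simp flip: z_def)
next
  fix n w assume "w \<in> block_alphabet A \<tau> n"
  then show "\<exists>u\<in>block_alphabet A \<tau> (Suc n). w \<in> set (block_subst \<tau> n u)"
    by (rule block_subst_covers[OF dir])
qed

section \<open>Decisiveness\<close>

lemma decisive_if_proper:
  assumes dir: "directive_sequence A \<tau>" and "everywhere_growing A \<tau>"
    and proper: "proper_sequence A \<tau>"
  shows "decisive A \<tau>"
  unfolding decisive_def
proof (intro conjI allI)
  fix n
  obtain b b' where b: "b \<in> A n" "b' \<in> A n"
    and ends: "\<And>a. a \<in> A (Suc n) \<Longrightarrow> prefix [b] (\<tau> n a) \<and> suffix [b'] (\<tau> n a)"
    using proper unfolding proper_sequence_def proper_def by metis
  show "\<exists>l \<in> A (Suc n) \<rightarrow> A n. \<exists>r \<in> A (Suc n) \<rightarrow> A n.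
        \<forall>a\<in>A (Suc n). \<forall>c\<in>A (Suc n). [a, c] \<in> language (subshift_level A \<tau> (Suc n)) \<longrightarrow>
          prefix [r a] (\<tau> n c) \<and> suffix [l c] (\<tau> n a)"
    using b ends by (intro bexI[of _ "\<lambda>_. b'"] bexI[of _ "\<lambda>_. b"]) auto
qed fact+

text \<open>
  At the junction of the images of \<open>[a0, a1, a2]\<close> and \<open>[a1, a2, a3]\<close>, the last and the first
  letter both straddle the boundary between the images of \<open>a1\<close> and \<open>a2\<close>, so they overlap as
  well.
\<close>

lemma successively_morph_block:
  assumes two: "\<And>a. a \<in> A (Suc n) \<Longrightarrow> 2 \<le> length (\<tau> n a)"
    and "w \<in> lists (block_alphabet A \<tau> (Suc n))"
    and "successively (\<lambda>u v. tl u = butlast v) w"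
  shows "successively (\<lambda>u v. tl u = butlast v) (morph (block_subst \<tau> n) w)"
  using assms(2,3)
proof (induction w rule: induct_list012)
  case 1
  then show ?case by simp
next
  case (2 u)
  have u: "u \<in> block_alphabet A \<tau> (Suc n)" using 2 by simp
  obtain a0 a1 a2 where "u = [a0, a1, a2]"
    "a0 \<in> A (Suc n)" "a1 \<in> A (Suc n)" "a2 \<in> A (Suc n)" by (rule block_alphabet_cases[OF u])
  moreover from this have "\<tau> n a0 \<noteq> []" "\<tau> n a2 \<noteq> []" using two by fastforce+
  ultimately show ?case by (simp add: block_subst_conv_triples successively_triples)
next
  case (3 u v w)
  have u: "u \<in> block_alphabet A \<tau> (Suc n)" and v: "v \<in> block_alphabet A \<tau> (Suc n)"
    using "3.prems" by simp_all
  obtain a0 a1 a2 where u_eq: "u = [a0, a1, a2]"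
    and a: "a0 \<in> A (Suc n)" "a1 \<in> A (Suc n)" "a2 \<in> A (Suc n)" by (rule block_alphabet_cases[OF u])
  obtain c1 c2 a3 where "v = [c1, c2, a3]" and a3: "a3 \<in> A (Suc n)"
    by (rule block_alphabet_cases[OF v])
  then have v_eq: "v = [a1, a2, a3]" using "3.prems"(2) by (simp add: u_eq)
  have ge: "2 \<le> length (\<tau> n a1)" "2 \<le> length (\<tau> n a2)" using two a by auto
  have ne: "\<tau> n a0 \<noteq> []" "\<tau> n a1 \<noteq> []" "\<tau> n a2 \<noteq> []" "\<tau> n a3 \<noteq> []" using two a a3 by fastforce+
  have "block_subst \<tau> n v \<noteq> []" using length_block_subst[of \<tau> n a1 a3 a2] ne v_eq by auto
  then have "hd (morph (block_subst \<tau> n) (v # w)) = hd (block_subst \<tau> n v)" by simp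
  then have "tl (last (block_subst \<tau> n u)) = butlast (hd (morph (block_subst \<tau> n) (v # w)))"
    using hd_block_subst[of \<tau> n a1 a2 a3] last_block_subst[of \<tau> n a0 a1 a2] ne ge u_eq v_eq
    by simp
  moreover have "successively (\<lambda>u v. tl u = butlast v) (block_subst \<tau> n u)"
    using ne by (simp add: u_eq block_subst_conv_triples successively_triples)
  moreover have "successively (\<lambda>u v. tl u = butlast v) (morph (block_subst \<tau> n) (v # w))"
    using "3.IH"(2) "3.prems" by simp
  ultimately show ?case
    unfolding morph_Cons[of _ u] successively_append_iff by blast
qed

lemma block_language_overlap:
  assumes dir: "directive_sequence A \<tau>"
    and two: "\<And>n a. a \<in> A (Suc n) \<Longrightarrow> 2 \<le> length (\<tau> n a)"
    and uv: "[u, v] \<in> language (subshift_level (block_alphabet A \<tau>) (block_subst \<tau>) n)"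
  shows "tl u = butlast v"
proof -
  let ?B = "block_alphabet A \<tau>" and ?\<sigma> = "block_subst \<tau>"
  from uv have "[u, v] \<in> generated ?B ?\<sigma> n"
    by (auto simp: language_def mem_subshift_level_iff)
  then obtain m c p s where m: "n < m" "c \<in> ?B m"
    and eq: "compose_range ?\<sigma> n m [c] = p @ [u, v] @ s"
    by (auto simp: generated_def sublist_def)
  have "n \<le> m" using m by simp
  then have "successively (\<lambda>u v. tl u = butlast v) (compose_range ?\<sigma> n m [c])"
  proof (induction rule: inc_induct)
    case base
    show ?case by simp
  next
    case (step k)
    have "compose_range ?\<sigma> (Suc k) m [c] \<in> lists (?B (Suc k))"
      using m step.hyps
      by (intro compose_range_in_lists[OF directive_sequence_block[OF dir two]]) auto
    from successively_morph_block[OF two this step.IH]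
    show ?case using step.hyps by (simp add: compose_range_step)
  qed
  then show ?thesis by (simp add: eq successively_append_iff)
qed

text \<open>
  For the pair \<open>[a0, a1, a2]\<close>, \<open>[a1, a2, a3]\<close>, the letters of the images at their junction are
  determined by the images of \<open>a1\<close> and \<open>a2\<close>, and both letters of the pair contain \<open>a1 a2\<close>.
\<close>

lemma decisive_block:
  assumes dir: "directive_sequence A \<tau>"
    and two: "\<And>n a. a \<in> A (Suc n) \<Longrightarrow> 2 \<le> length (\<tau> n a)"
  shows "decisive (block_alphabet A \<tau>) (block_subst \<tau>)"
  unfolding decisive_def
proof (intro conjI allI)
  let ?B = "block_alphabet A \<tau>" and ?\<sigma> = "block_subst \<tau>"
  show dirB: "directive_sequence ?B ?\<sigma>" by (rule directive_sequence_block[OF dir two])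
  have twoB: "2 \<le> length (?\<sigma> n u)" if u: "u \<in> ?B (Suc n)" for n u
  proof -
    obtain a0 a1 a2 where a: "u = [a0, a1, a2]"
      "a0 \<in> A (Suc n)" "a1 \<in> A (Suc n)" "a2 \<in> A (Suc n)" by (rule block_alphabet_cases[OF u])
    then have "\<tau> n a0 \<noteq> []" "\<tau> n a2 \<noteq> []" using two by fastforce+
    then show ?thesis using two[OF a(3)] by (simp add: a(1) length_block_subst)
  qed
  show "everywhere_growing ?B ?\<sigma>" by (rule everywhere_growing_if_images_ge_2[OF dirB twoB])
  fix n
  define l where "l v = [last (butlast (\<tau> n (v ! 0))), last (\<tau> n (v ! 0)), hd (\<tau> n (v ! 1))]" for v
  define r where "r u = [last (\<tau> n (u ! 1)), hd (\<tau> n (u ! 2)), hd (tl (\<tau> n (u ! 2)))]" for u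
  have sublist_in: "w \<in> ?B n"
    if "u \<in> ?B (Suc n)" and "sublist w (morph (\<tau> n) u)" and "length w = 3" for u w
    using that language_sublist morph_language[OF dir]
    by (fastforce simp: block_alphabet_def language_len_def)
  have l_in: "l u \<in> ?B n" and r_in: "r u \<in> ?B n" if u: "u \<in> ?B (Suc n)" for u
  proof -
    obtain a0 a1 a2 where u_eq: "u = [a0, a1, a2]"
      and a: "a0 \<in> A (Suc n)" "a1 \<in> A (Suc n)" "a2 \<in> A (Suc n)" by (rule block_alphabet_cases[OF u])
    obtain p x y where p: "\<tau> n a0 = p @ [x, y]"
      using two[OF a(1)]
      by (cases "\<tau> n a0" rule: rev_cases; cases "butlast (\<tau> n a0)" rule: rev_cases) auto
    obtain q z where q: "\<tau> n a1 = q @ [z]"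
      using two[OF a(2)] by (cases "\<tau> n a1" rule: rev_cases) auto
    then have "q \<noteq> []" using two[OF a(2)] by auto
    obtain c d s where s: "\<tau> n a2 = c # d # s"
      using two[OF a(3)] by (metis Suc_le_length_iff numeral_2_eq_2)
    have "morph (\<tau> n) u = p @ l u @ (tl (\<tau> n a1) @ \<tau> n a2)"
      using q by (cases q) (simp_all add: u_eq l_def p butlast_append)
    then show "l u \<in> ?B n"
      by (intro sublist_in[OF u]) (simp_all only: sublist_appendI, simp add: l_def)
    have "morph (\<tau> n) u = (\<tau> n a0 @ q) @ r u @ s" by (simp add: u_eq r_def q s)
    then show "r u \<in> ?B n"
      by (intro sublist_in[OF u]) (simp_all only: sublist_appendI, simp add: r_def)
  qed
  have junction: "prefix [r u] (?\<sigma> n v) \<and> suffix [l v] (?\<sigma> n u)"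
    if u: "u \<in> ?B (Suc n)" and v: "v \<in> ?B (Suc n)"
      and uv: "[u, v] \<in> language (subshift_level ?B ?\<sigma> (Suc n))" for u v
  proof -
    obtain a0 a1 a2 where u_eq: "u = [a0, a1, a2]"
      and a: "a0 \<in> A (Suc n)" "a1 \<in> A (Suc n)" "a2 \<in> A (Suc n)" by (rule block_alphabet_cases[OF u])
    obtain c1 c2 a3 where "v = [c1, c2, a3]" and a3: "a3 \<in> A (Suc n)"
      by (rule block_alphabet_cases[OF v])
    then have v_eq: "v = [a1, a2, a3]"
      using block_language_overlap[OF dir two uv] by (simp add: u_eq)
    have ge: "2 \<le> length (\<tau> n a1)" "2 \<le> length (\<tau> n a2)" using two a by auto
    have ne: "\<tau> n a0 \<noteq> []" "\<tau> n a1 \<noteq> []" "\<tau> n a2 \<noteq> []" "\<tau> n a3 \<noteq> []"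
      using two a a3 by fastforce+
    have "hd (?\<sigma> n v) = r u" using hd_block_subst[of \<tau> n a1 a2 a3] ne ge by (simp add: u_eq v_eq r_def)
    moreover have "last (?\<sigma> n u) = l v"
      using last_block_subst[of \<tau> n a0 a1 a2] ne ge by (simp add: u_eq v_eq l_def)
    moreover have "?\<sigma> n u \<noteq> []" "?\<sigma> n v \<noteq> []" using twoB u v by fastforce+
    ultimately show ?thesis
      by (metis append_Cons append_Nil append_butlast_last_id list.collapse prefixI suffixI)
  qed
  show "\<exists>l \<in> ?B (Suc n) \<rightarrow> ?B n. \<exists>r \<in> ?B (Suc n) \<rightarrow> ?B n.
        \<forall>u\<in>?B (Suc n). \<forall>v\<in>?B (Suc n). [u, v] \<in> language (subshift_level ?B ?\<sigma> (Suc n)) \<longrightarrow>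
          prefix [r u] (?\<sigma> n v) \<and> suffix [l v] (?\<sigma> n u)"
    using l_in r_in junction by (intro bexI[of _ l] bexI[of _ r]) auto
qed

theorem proposition3p20:
  fixes A :: "nat \<Rightarrow> 'a set" and \<tau> :: "nat \<Rightarrow> 'a \<Rightarrow> 'a list"
  assumes "\<forall>n. alphabet (A n)"
    and "directive_sequence A \<tau>"
    and "everywhere_growing A \<tau>"
  shows "(proper_sequence A \<tau> \<longrightarrow> decisive A \<tau>) \<and>
         ((\<forall>n. \<forall>a\<in>A (Suc n). length (\<tau> n a) \<ge> 2) \<longrightarrow>
            decisive (block_alphabet A \<tau>) (block_subst \<tau>))"
  using decisive_if_proper[OF assms(2,3)] decisive_block[OF assms(2)] by blast

end
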